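(* Let $i,j\in\{+,-\}$, let $u^{(0,0)}>0$ and let $\phi=(\phi_x,\phi_y)^T\in\mathcal S_{ij}$ with $\phi\neq 0$. Put $r=\|\phi\|_2$ and define $$\zeta_0=-\frac{2\pi-3\pi\sqrt2+4}{3\pi(\sqrt2-1)},\qquad \zeta=1-\sqrt2\,(1-\zeta_0)\,r,$$ $$\alpha_1=|\phi_x\phi_y|\left(\frac83-\frac{16}{3\pi}\right)(1-r^2),\qquad \alpha_2=\zeta r^2+(1-\zeta)r-\alpha_1,$$ and the first-order quarter-moment Kershaw ($\mathrm{QK}_1$) closure $$\phi^{|2|}=\alpha_1 I+\alpha_2\,\frac{\phi\phi^T}{r^2}\in\mathbb{R}^{2\times 2}.$$ Then the $\mathrm{QK}_1$ closure is realizable: there exists a non-negative measure $\psi$ on $\mathcal S_{ij}$ such that $$\int_{\mathcal S_{ij}}\psi\,d\Omega=u^{(0,0)},\qquad \int_{\mathcal S_{ij}}\Omega\,\psi\,d\Omega=u^{(0,0)}\phi,\qquad \int_{\mathcal S_{ij}}\Omega\Omega^T\psi\,d\Omega=u^{(0,0)}\phi^{|2|}.$$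
   Context: Points of the unit sphere $S^2\subset\mathbb{R}^3$ are parametrized by $\mu\in[-1,1]$ (cosine of the polar angle) and the azimuthal angle $\varphi$. By symmetry in the $z$-direction only the first two components are used: $\Omega=(\Omega_x,\Omega_y)^T=(\sqrt{1-\mu^2}\cos\varphi,\sqrt{1-\mu^2}\sin\varphi)^T$, so $\|\Omega\|_2\le 1$. The quarter-spaces are the sets of all $\Omega$ with $\mu\in[-1,1]$ and $\varphi\in[0,\pi/2]$ for $\mathcal S_{++}$, $\varphi\in[\pi/2,\pi]$ for $\mathcal S_{-+}$, $\varphi\in[\pi,3\pi/2]$ for $\mathcal S_{--}$, $\varphi\in[3\pi/2,2\pi]$ for $\mathcal S_{+-}$. Viewed as a set of vectors in $\mathbb{R}^2$, $\mathcal S_{ij}$ is the closed quarter of the unit disk $\{(x,y):x^2+y^2\le 1,\ ix\ge 0,\ jy\ge 0\}$; membership $\phi\in\mathcal S_{ij}$ is understood in this sense. Measures are finite and non-negative (Dirac masses are allowed, including on the boundary of $\mathcal S_{ij}$, where they count with full mass). $I$ is the $2\times2$ identity matrix. *)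

theory Defs
  imports "HOL-Analysis.Analysis"
begin

datatype orientation = Plus | Minus

fun orientation_sign :: "orientation \<Rightarrow> real" where
  "orientation_sign Plus = 1"
| "orientation_sign Minus = -1"

fun azimuth_range :: "orientation \<Rightarrow> orientation \<Rightarrow> real set" where
  "azimuth_range Plus Plus = {0..pi/2}"
| "azimuth_range Minus Plus = {pi/2..pi}"
| "azimuth_range Minus Minus = {pi..3*pi/2}"
| "azimuth_range Plus Minus = {3*pi/2..2*pi}"

text \<open>The first two components of the point of the unit sphere whose polar angle has cosine
  \<open>\<mu>\<close> and whose azimuthal angle is \<open>\<theta>\<close>.\<close>

definition direction :: "real \<Rightarrow> real \<Rightarrow> real^2" where
  "direction \<mu> \<theta> = vector [sqrt (1 - \<mu>\<^sup>2) * cos \<theta>, sqrt (1 - \<mu>\<^sup>2) * sin \<theta>]"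

definition quarter_space :: "orientation \<Rightarrow> orientation \<Rightarrow> (real^2) set" where
  "quarter_space i j =
     {direction \<mu> \<theta> | \<mu> \<theta>. \<mu> \<in> {-1..1} \<and> \<theta> \<in> azimuth_range i j}"

definition outer_square :: "real^2 \<Rightarrow> real^2^2" where
  "outer_square v = (columnvector v :: real^1^2) ** rowvector v"

definition qk1_zeta0 :: real where
  "qk1_zeta0 = - (2 * pi - 3 * pi * sqrt 2 + 4) / (3 * pi * (sqrt 2 - 1))"

definition qk1_zeta :: "real^2 \<Rightarrow> real" where
  "qk1_zeta \<phi> = 1 - sqrt 2 * (1 - qk1_zeta0) * norm \<phi>"

definition qk1_alpha1 :: "real^2 \<Rightarrow> real" where
  "qk1_alpha1 \<phi> = \<bar>\<phi>$1 * \<phi>$2\<bar> * (8/3 - 16 / (3 * pi)) * (1 - (norm \<phi>)\<^sup>2)"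

definition qk1_alpha2 :: "real^2 \<Rightarrow> real" where
  "qk1_alpha2 \<phi> =
     qk1_zeta \<phi> * (norm \<phi>)\<^sup>2 + (1 - qk1_zeta \<phi>) * norm \<phi> - qk1_alpha1 \<phi>"

definition qk1_closure :: "real^2 \<Rightarrow> real^2^2" where
  "qk1_closure \<phi> =
     qk1_alpha1 \<phi> *\<^sub>R mat 1 + (qk1_alpha2 \<phi> / (norm \<phi>)\<^sup>2) *\<^sub>R outer_square \<phi>"

lemma outer_square_nth: "outer_square v $ k $ l = v $ k * v $ l"
  by (simp add: outer_square_def columnvector_def rowvector_def matrix_matrix_mult_def)

lemma norm_vec2: "norm (v::real^2) = sqrt ((v$1)\<^sup>2 + (v$2)\<^sup>2)"
  by (simp add: norm_vec_def L2_set_def sum_2)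

lemma direction_nth:
  "direction \<mu> \<theta> $ 1 = sqrt (1 - \<mu>\<^sup>2) * cos \<theta>"
  "direction \<mu> \<theta> $ 2 = sqrt (1 - \<mu>\<^sup>2) * sin \<theta>"
  by (simp_all add: direction_def vector_2)

lemma azimuth_range_signs:
  assumes "\<theta> \<in> azimuth_range i j"
  shows "0 \<le> orientation_sign i * cos \<theta>" and "0 \<le> orientation_sign j * sin \<theta>"
proof -
  have "0 \<le> orientation_sign i * cos \<theta> \<and> 0 \<le> orientation_sign j * sin \<theta>"
  proof (cases i; cases j)
    assume "i = Plus" "j = Plus"
    then show ?thesis using assms by (auto intro!: cos_ge_zero sin_ge_zero)
  next
    assume ij: "i = Minus" "j = Plus"
    have "0 \<le> sin \<theta>" using assms ij by (auto intro!: sin_ge_zero)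
    moreover have "0 \<le> sin (\<theta> - pi/2)" using assms ij by (intro sin_ge_zero) auto
    ultimately show ?thesis using ij by (simp add: sin_diff)
  next
    assume ij: "i = Minus" "j = Minus"
    have "0 \<le> cos (\<theta> - pi)" using assms ij by (intro cos_ge_zero) auto
    moreover have "0 \<le> sin (\<theta> - pi)" using assms ij by (intro sin_ge_zero) auto
    ultimately show ?thesis using ij by (simp add: cos_diff sin_diff)
  next
    assume ij: "i = Plus" "j = Minus"
    have "0 \<le> cos (\<theta> - 2 * pi)" using assms ij by (intro cos_ge_zero) auto
    moreover have "0 \<le> sin (\<theta> - pi)" using assms ij by (intro sin_ge_zero) auto
    ultimately show ?thesis using ij by (simp add: cos_diff sin_diff)
  qed
  then show "0 \<le> orientation_sign i * cos \<theta>" and "0 \<le> orientation_sign j * sin \<theta>"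
    by auto
qed

lemma azimuth_range_exists:
  assumes "0 \<le> orientation_sign i * x" and "0 \<le> orientation_sign j * y" and "x\<^sup>2 + y\<^sup>2 = 1"
  shows "\<exists>\<theta>\<in>azimuth_range i j. cos \<theta> = x \<and> sin \<theta> = y"
proof -
  have "\<bar>x\<bar>\<^sup>2 + \<bar>y\<bar>\<^sup>2 = 1"
    using assms by simp
  then obtain t where t: "0 \<le> t" "t \<le> pi/2" "\<bar>x\<bar> = cos t" "\<bar>y\<bar> = sin t"
    using sincos_total_pi_half[of "\<bar>x\<bar>" "\<bar>y\<bar>"] by auto
  show ?thesis
  proof (cases i; cases j)
    assume "i = Plus" "j = Plus"
    then show ?thesis using assms t by (auto intro!: bexI[of _ t])
  next
    assume "i = Minus" "j = Plus"
    then show ?thesis using assms t by (auto intro!: bexI[of _ "pi - t"] simp: cos_diff sin_diff)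
  next
    assume "i = Minus" "j = Minus"
    then show ?thesis using assms t by (auto intro!: bexI[of _ "pi + t"] simp: cos_add sin_add)
  next
    assume "i = Plus" "j = Minus"
    then show ?thesis using assms t
      by (auto intro!: bexI[of _ "2 * pi - t"] simp: cos_diff sin_diff)
  qed
qed

lemma quarter_space_iff:
  "v \<in> quarter_space i j \<longleftrightarrow>
     norm v \<le> 1 \<and> 0 \<le> orientation_sign i * v$1 \<and> 0 \<le> orientation_sign j * v$2"
proof
  assume "v \<in> quarter_space i j"
  then obtain \<mu> \<theta> where \<mu>: "\<mu> \<in> {-1..1}" and \<theta>: "\<theta> \<in> azimuth_range i j"
    and v: "v = direction \<mu> \<theta>"
    by (auto simp: quarter_space_def)
  have \<mu>2: "0 \<le> 1 - \<mu>\<^sup>2" "1 - \<mu>\<^sup>2 \<le> 1"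
    using \<mu> by (auto simp: abs_square_le_1)
  have "(v$1)\<^sup>2 + (v$2)\<^sup>2 = (1 - \<mu>\<^sup>2) * ((cos \<theta>)\<^sup>2 + (sin \<theta>)\<^sup>2)"
    using \<mu>2 by (simp only: v direction_nth power_mult_distrib real_sqrt_pow2 distrib_left)
  then have "norm v \<le> 1"
    using \<mu>2 by (simp add: norm_vec2)
  moreover have "0 \<le> sqrt (1 - \<mu>\<^sup>2) * (orientation_sign i * cos \<theta>)"
    "0 \<le> sqrt (1 - \<mu>\<^sup>2) * (orientation_sign j * sin \<theta>)"
    using \<mu>2 azimuth_range_signs[OF \<theta>] by (auto intro!: mult_nonneg_nonneg)
  ultimately show "norm v \<le> 1 \<and> 0 \<le> orientation_sign i * v$1 \<and> 0 \<le> orientation_sign j * v$2"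
    by (simp add: v direction_nth mult.left_commute)
next
  assume v: "norm v \<le> 1 \<and> 0 \<le> orientation_sign i * v$1 \<and> 0 \<le> orientation_sign j * v$2"
  define r where "r = norm v"
  have r: "0 \<le> r" "r \<le> 1" "r\<^sup>2 = (v$1)\<^sup>2 + (v$2)\<^sup>2"
    using v by (auto simp: r_def norm_vec2)
  have "\<exists>\<theta>\<in>azimuth_range i j. v$1 = r * cos \<theta> \<and> v$2 = r * sin \<theta>"
  proof (cases "r = 0")
    case True
    then have "v = 0" by (simp add: r_def)
    moreover have "azimuth_range i j \<noteq> {}" by (cases i; cases j) auto
    ultimately show ?thesis using True by auto
  next
    case False
    then have pos: "r > 0" using r by simp
    have "(v$1 / r)\<^sup>2 + (v$2 / r)\<^sup>2 = 1"
      unfolding power_divide add_divide_distrib[symmetric] r(3)[symmetric] using False by simp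
    moreover have "0 \<le> orientation_sign i * (v$1 / r)" "0 \<le> orientation_sign j * (v$2 / r)"
      using v pos by (simp_all add: zero_le_divide_iff)
    ultimately obtain \<theta> where "\<theta> \<in> azimuth_range i j" "cos \<theta> = v$1 / r" "sin \<theta> = v$2 / r"
      using azimuth_range_exists by blast
    then show ?thesis
      using False by (intro bexI[of _ \<theta>]) auto
  qed
  then obtain \<theta> where \<theta>: "\<theta> \<in> azimuth_range i j" "v$1 = r * cos \<theta>" "v$2 = r * sin \<theta>"
    by blast
  have r2: "r\<^sup>2 \<le> 1" using r(1,2) by (simp add: power_le_one)
  have "v = direction (sqrt (1 - r\<^sup>2)) \<theta>"
    using \<theta> r(1) r2 by (simp add: vec_eq_iff forall_2 direction_nth)
  moreover have "sqrt (1 - r\<^sup>2) \<in> {-1..1}"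
    using r2 real_sqrt_ge_zero[of "1 - r\<^sup>2"] by (auto intro: order_trans[of _ 0])
  ultimately show "v \<in> quarter_space i j"
    using \<theta>(1) unfolding quarter_space_def by blast
qed

end

theory Submission
  imports Defs
begin

text \<open>
  Write \<open>r\<close> for the norm of \<open>\<phi>\<close>, \<open>n = \<phi> / r\<close> and \<open>n'\<close> for the unit vector orthogonal to \<open>n\<close>. With
  \<open>\<kappa> = sqrt 2 * (1 - \<zeta>\<^sub>0)\<close>, the closure prescribes uncorrelated coordinates along \<open>n\<close> and \<open>n'\<close>,
  with variances \<open>\<kappa> * r\<^sup>2 * (1 - r)\<close> and \<open>\<alpha>\<^sub>1\<close>. Four atoms realize it: mass \<open>\<kappa> * r\<close>
  is put on \<open>0\<close> and \<open>n\<close> with mean \<open>\<phi>\<close>, which produces exactly the variance along \<open>n\<close>; the remaining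
  mass is put on \<open>\<phi> + a * n'\<close> and \<open>\<phi> - b * n'\<close> with mean \<open>\<phi>\<close>, which produces the variance
  \<open>(1 - \<kappa> * r) * a * b\<close> along \<open>n'\<close>. Since \<open>\<kappa> \<le> 1/2\<close> and \<open>8/3 - 16/(3 * pi) \<le> 1\<close>, the required
  product \<open>a * b\<close> is small enough for both atoms to fit into the quarter disk.
\<close>

section \<open>Moments of finitely supported measures\<close>

text \<open>Atoms are indexed rather than collected in a set, so points may coincide; their weights
  then add up.\<close>

lemma has_bochner_integral_point_measure_distr:
  fixes g :: "'b :: topological_space \<Rightarrow> 'c :: {banach, second_countable_topology}"
  assumes "finite I" and w: "\<And>k. k \<in> I \<Longrightarrow> 0 \<le> w k" and "f ` I \<subseteq> Q"
    and "continuous_on UNIV g"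
  shows "has_bochner_integral
           (distr (point_measure I (\<lambda>k. ennreal (w k))) (restrict_space borel Q) f) g
           (\<Sum>k\<in>I. w k *\<^sub>R g (f k))"
proof -
  have f: "f \<in> point_measure I (\<lambda>k. ennreal (w k)) \<rightarrow>\<^sub>M restrict_space borel Q"
    using assms(3) by (auto simp: measurable_point_measure_eq1 space_restrict_space)
  have g: "g \<in> borel_measurable (restrict_space borel Q)"
    by (intro measurable_restrict_space1 borel_measurable_continuous_onI assms(4))
  show ?thesis
    using assms(1) w f g
    by (simp add: has_bochner_integral_iff integrable_distr_eq integral_distr
        integrable_point_measure_finite lebesgue_integral_point_measure_finite)
qed

lemma finite_measure_point_measure_distr:
  assumes "finite I" and "f ` I \<subseteq> Q"
  shows "finite_measure
           (distr (point_measure I (\<lambda>k. ennreal (w k))) (restrict_space borel Q) f)"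
proof -
  have f: "f \<in> point_measure I (\<lambda>k. ennreal (w k)) \<rightarrow>\<^sub>M restrict_space borel Q"
    using assms(2) by (auto simp: measurable_point_measure_eq1 space_restrict_space)
  have "finite_measure (point_measure I (\<lambda>k. ennreal (w k)))"
    using assms(1)
    by (intro finite_measureI) (simp add: space_point_measure emeasure_point_measure_finite)
  then show ?thesis
    using f by (rule finite_measure.finite_measure_distr)
qed

lemma continuous_on_outer_square: "continuous_on UNIV outer_square"
proof -
  have eq: "outer_square = (\<lambda>v :: real^2. \<chi> k. \<chi> l. v $ k * v $ l)"
    by (simp add: fun_eq_iff vec_eq_iff outer_square_nth)
  show ?thesis
    unfolding eq by (intro continuous_intros)
qed

section \<open>The quarter disk in rotated coordinates\<close>

text \<open>The point with coordinates \<open>X\<close>, \<open>Y\<close> along \<open>(\<sigma> c, \<tau> s)\<close> and \<open>(- \<sigma> s, \<tau> c)\<close>, where \<open>\<sigma>\<close>, \<open>\<tau>\<close> are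
  the signs of the quarter.\<close>

definition rotated_point ::
    "orientation \<Rightarrow> orientation \<Rightarrow> real \<Rightarrow> real \<Rightarrow> real \<Rightarrow> real \<Rightarrow> real^2" where
  "rotated_point i j c s X Y =
     vector [orientation_sign i * (X * c - Y * s), orientation_sign j * (X * s + Y * c)]"

lemma rotated_point_nth:
  "rotated_point i j c s X Y $ 1 = orientation_sign i * (X * c - Y * s)"
  "rotated_point i j c s X Y $ 2 = orientation_sign j * (X * s + Y * c)"
  by (simp_all add: rotated_point_def vector_2)

lemma orientation_sign_square: "orientation_sign i * orientation_sign i = 1"
  by (cases i) simp_all

lemma rotated_point_in_quarter_space:
  assumes "c\<^sup>2 + s\<^sup>2 = 1" and "X\<^sup>2 + Y\<^sup>2 \<le> 1" and "Y * s \<le> X * c" and "- Y * c \<le> X * s"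
  shows "rotated_point i j c s X Y \<in> quarter_space i j"
proof -
  have "(orientation_sign i * (X * c - Y * s))\<^sup>2 + (orientation_sign j * (X * s + Y * c))\<^sup>2
      = (X\<^sup>2 + Y\<^sup>2) * (c\<^sup>2 + s\<^sup>2)"
    by (simp add: power_mult_distrib power2_eq_square[of "orientation_sign _"]
        orientation_sign_square) (simp add: power2_eq_square algebra_simps)
  then have "norm (rotated_point i j c s X Y) \<le> 1"
    using assms by (simp add: norm_vec2 rotated_point_nth)
  then show ?thesis
    using assms
    by (simp add: quarter_space_iff rotated_point_nth mult.assoc[symmetric]
        orientation_sign_square)
qed

lemma mult_sqrt_complement_le_half:
  fixes r :: real
  assumes "r\<^sup>2 \<le> 1"
  shows "r * sqrt (1 - r\<^sup>2) \<le> 1/2"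
proof -
  have "0 \<le> (r - sqrt (1 - r\<^sup>2))\<^sup>2" by simp
  then show ?thesis
    using assms by (simp add: power2_diff)
qed

text \<open>The constraints on \<open>a\<close>, \<open>b\<close> say that \<open>(r, a)\<close> and \<open>(r, - b)\<close> are rotated coordinates of points
  of the quarter disk; \<open>l\<close> and \<open>1 - l\<close> are the weights that centre the two points.\<close>

lemma transverse_atoms:
  fixes c s r g :: real
  assumes "0 \<le> c" "0 \<le> s" and cs: "c\<^sup>2 + s\<^sup>2 = 1" and r: "0 < r" "r \<le> 1"
    and g: "0 \<le> g" "g \<le> 2"
  obtains a b l where "0 \<le> a" "0 \<le> b" "a * s \<le> r * c" "b * c \<le> r * s" "r\<^sup>2 + a\<^sup>2 \<le> 1" "r\<^sup>2 + b\<^sup>2 \<le> 1"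
    "a * b = g * (c * s * r\<^sup>2 * (1 - r\<^sup>2))" "0 \<le> l" "l \<le> 1" "l * a = (1 - l) * b"
proof (cases "g * (c * s * r\<^sup>2 * (1 - r\<^sup>2)) = 0")
  case True
  have "r\<^sup>2 \<le> 1" using r by (simp add: power_le_one)
  \<comment> \<open>No transverse spread is required: both points collapse to
    \<open>(r, 0)\<close>.\<close>
  with True show ?thesis
    using assms by (intro that[of 0 0 0]) auto
next
  case False
  define q where "q = sqrt (1 - r\<^sup>2)"
  define D where "D = g * (c * s * r\<^sup>2 * q\<^sup>2)"
  have r2: "r\<^sup>2 \<le> 1" using r by (simp add: power_le_one)
  then have q2: "q\<^sup>2 = 1 - r\<^sup>2" by (simp add: q_def)
  have pos: "0 < g" "0 < c" "0 < s" "0 < q"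
    using False assms r2 unfolding q_def by (auto simp: less_le)
  then have D: "0 < D" using r by (simp add: D_def)
  \<comment> \<open>The AM-GM bounds \<open>r * q \<le> 1/2\<close> and
    \<open>c * s \<le> 1/2\<close> exactly offset \<open>g \<le> 2\<close>.\<close>
  have rq: "r * q \<le> 1/2"
    unfolding q_def by (rule mult_sqrt_complement_le_half[OF r2])
  have "0 \<le> (c - s)\<^sup>2" by simp
  then have "c * s \<le> 1/2" using cs by (simp add: power2_diff)
  then have gcs: "g * (c * s) \<le> 1"
    using mult_mono[of g 2 "c * s" "1/2"] g pos by simp
  have grq: "g * (r * q) \<le> 1"
    using mult_mono[of g 2 "r * q" "1/2"] g rq r pos by simp
  have c2: "c\<^sup>2 \<le> 1" "s\<^sup>2 \<le> 1" using cs zero_le_power2[of c] zero_le_power2[of s] by linarith+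
  have q21: "q\<^sup>2 \<le> 1" using q2 by simp
  \<comment> \<open>\<open>a\<close> is the largest offset allowed by the half-plane and by the
    chord of half-length \<open>q\<close>, which makes \<open>b\<close> as small as the product
    permits. In the two cases of the minimum, \<open>D1\<close> and \<open>D3\<close> yield
    \<open>b * c \<le> r * s\<close>, while \<open>D4\<close> and \<open>D2\<close> yield
    \<open>b \<le> q\<close>.\<close>
  define a where "a = min (r * c / s) q"
  define b where "b = D / a"
  have a: "0 < a" using pos r by (simp add: a_def)
  then have b: "0 < b" using D by (simp add: b_def)
  have D1: "D \<le> r\<^sup>2"
  proof -
    have "D = (g * (c * s)) * q\<^sup>2 * r\<^sup>2" by (simp add: D_def)
    also have "\<dots> \<le> 1 * 1 * r\<^sup>2"
      using gcs q21 pos by (intro mult_mono) auto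
    finally show ?thesis by simp
  qed
  have D2: "D \<le> q\<^sup>2"
  proof -
    have "D = (g * (c * s)) * r\<^sup>2 * q\<^sup>2" by (simp add: D_def)
    also have "\<dots> \<le> 1 * 1 * q\<^sup>2"
      using gcs r2 pos by (intro mult_mono) auto
    finally show ?thesis by simp
  qed
  have D3: "D * c \<le> q * (r * s)"
  proof -
    have "D * c = (g * (r * q)) * c\<^sup>2 * (q * (r * s))"
      by (simp add: D_def power2_eq_square)
    also have "\<dots> \<le> 1 * 1 * (q * (r * s))"
      using grq c2 pos r by (intro mult_mono) auto
    finally show ?thesis by simp
  qed
  have D4: "D \<le> (r * c / s) * q"
  proof -
    have "D * s = (g * (r * q)) * s\<^sup>2 * (r * c * q)"
      by (simp add: D_def power2_eq_square)
    also have "\<dots> \<le> 1 * 1 * (r * c * q)"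
      using grq c2 pos r by (intro mult_mono) auto
    finally show ?thesis using pos by (simp add: field_simps)
  qed
  have ab: "a * b = D" using a by (simp add: b_def)
  have as: "a * s \<le> r * c"
  proof -
    have "a \<le> r * c / s" by (simp add: a_def)
    then show ?thesis using pos by (simp add: field_simps)
  qed
  have aq: "a \<le> q" by (simp add: a_def)
  have "D * c \<le> r * s * a"
    using D1 D3 pos by (auto simp: a_def min_def power2_eq_square algebra_simps)
  then have bc: "b * c \<le> r * s"
    using a by (simp add: b_def field_simps)
  have "D \<le> q * a"
    using D2 D4 by (auto simp: a_def min_def power2_eq_square mult.commute)
  then have bq: "b \<le> q"
    using a by (simp add: b_def field_simps)
  have "a\<^sup>2 \<le> q\<^sup>2" "b\<^sup>2 \<le> q\<^sup>2"
    using aq bq a b by (auto intro!: power_mono)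
  then show ?thesis
    using as bc ab a b q2
    by (intro that[of a b "b / (a + b)"]) (auto simp: D_def field_simps)
qed

lemma centred_first_moment:
  fixes l a b x y :: real
  assumes "l * a = (1 - l) * b"
  shows "l * (x + a * y) + (1 - l) * (x - b * y) = x"
  using assms by algebra

text \<open>Centring cancels the cross terms; \<open>l * a * a\<close> becomes
  \<open>(1 - l) * a * b\<close> and \<open>(1 - l) * b * b\<close> becomes
  \<open>l * a * b\<close>, which add up to \<open>a * b\<close>.\<close>

lemma centred_second_moment:
  fixes l a b x x' y y' :: real
  assumes "l * a = (1 - l) * b"
  shows "l * ((x + a * y) * (x' + a * y')) + (1 - l) * ((x - b * y) * (x' - b * y'))
    = x * x' + a * b * (y * y')"
  using assms by algebra

section \<open>The constants and the shape of the closure\<close>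

lemma qk1_kappa_bounds: "0 \<le> sqrt 2 * (1 - qk1_zeta0)" "sqrt 2 * (1 - qk1_zeta0) \<le> 1/2"
proof -
  have sq: "1 < sqrt (2::real)" "sqrt (2::real) < 3/2"
    using real_less_lsqrt[of "3/2" 2] by (simp_all add: power2_eq_square)
  \<comment> \<open>Expanding the fraction by \<open>sqrt 2 + 1\<close> removes
    \<open>sqrt 2 - 1\<close> from the denominator.\<close>
  have eq: "sqrt 2 * (1 - qk1_zeta0) = (4 - pi) * (2 + sqrt 2) / (3 * pi)"
    using sq by (simp add: qk1_zeta0_def field_simps)
  show "0 \<le> sqrt 2 * (1 - qk1_zeta0)"
    unfolding eq using sq pi_less_4 by simp
  have "(4 - pi) * (2 + sqrt 2) \<le> 1 * (7/2)"
    using sq pi_gt3 pi_less_4 by (intro mult_mono) auto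
  then show "sqrt 2 * (1 - qk1_zeta0) \<le> 1/2"
    unfolding eq using pi_gt3 by (simp add: field_simps)
qed

lemma qk1_beta_bounds: "0 \<le> 8/3 - 16 / (3 * pi)" "8/3 - 16 / (3 * pi) \<le> 1"
proof -
  \<comment> \<open>\<open>16/5\<close> is the exact threshold for the upper bound.\<close>
  have "pi \<le> 16/5" using pi_approx by (simp add: abs_le_iff)
  then show "0 \<le> 8/3 - 16 / (3 * pi)" "8/3 - 16 / (3 * pi) \<le> 1"
    using pi_gt3 by (simp_all add: field_simps)
qed

text \<open>The first bracket is the projection onto the direction orthogonal to
  \<open>\<phi>\<close>, so its factor is the transverse variance; the second term is squared mean
  plus variance along \<open>\<phi>\<close>.\<close>

lemma qk1_closure_decomposition:
  fixes \<phi> :: "real^2"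
  assumes "\<phi> \<noteq> 0"
  defines "\<kappa> \<equiv> sqrt 2 * (1 - qk1_zeta0)"
  shows "qk1_closure \<phi> = qk1_alpha1 \<phi> *\<^sub>R (mat 1 - (1 / (norm \<phi>)\<^sup>2) *\<^sub>R outer_square \<phi>)
           + (1 + \<kappa> * (1 - norm \<phi>)) *\<^sub>R outer_square \<phi>"
proof -
  define A where "A = qk1_alpha1 \<phi>"
  have r: "0 < norm \<phi>" using assms by simp
  then have eq: "qk1_alpha2 \<phi> / (norm \<phi>)\<^sup>2 = 1 + \<kappa> * (1 - norm \<phi>) - A / (norm \<phi>)\<^sup>2"
    unfolding qk1_alpha2_def qk1_zeta_def A_def[symmetric] \<kappa>_def[symmetric]
    by (simp add: field_simps power2_eq_square)
  show ?thesis
    unfolding qk1_closure_def eq A_def[symmetric] by (simp add: algebra_simps)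
qed

section \<open>The four-atom measure and its moments\<close>

theorem mainTheorem3:
  fixes i j :: orientation and u :: real and \<phi> :: "real^2"
  assumes "u > 0" and "\<phi> \<in> quarter_space i j" and "\<phi> \<noteq> 0"
  shows "\<exists>\<psi> :: (real^2) measure.
           finite_measure \<psi> \<and>
           sets \<psi> = sets (restrict_space borel (quarter_space i j)) \<and>
           has_bochner_integral \<psi> (\<lambda>\<Omega>. 1) u \<and>
           has_bochner_integral \<psi> (\<lambda>\<Omega>. \<Omega>) (u *\<^sub>R \<phi>) \<and>
           has_bochner_integral \<psi> outer_square (u *\<^sub>R qk1_closure \<phi>)"
proof -
  define r where "r = norm \<phi>"
  define \<sigma> where "\<sigma> = orientation_sign i"
  define \<tau> where "\<tau> = orientation_sign j"
  \<comment> \<open>The signs reflect \<open>\<phi>\<close> into the first quadrant, so all four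
    quarters are treated at once.\<close>
  define c where "c = \<sigma> * \<phi>$1 / r"
  define s where "s = \<tau> * \<phi>$2 / r"
  define \<beta> where "\<beta> = 8/3 - 16 / (3 * pi)"
  define \<kappa> where "\<kappa> = sqrt 2 * (1 - qk1_zeta0)"
  define p where "p = \<kappa> * r"
  \<comment> \<open>Only the mass fraction \<open>1 - p\<close> carries transverse variance, hence
    the division; \<open>p \<le> 1/2\<close> then gives \<open>g \<le> 2\<close>.\<close>
  define g where "g = \<beta> / (1 - p)"
  have \<sigma>\<tau>: "\<sigma> * \<sigma> = 1" "\<tau> * \<tau> = 1"
    by (simp_all add: \<sigma>_def \<tau>_def orientation_sign_square)
  have r: "0 < r" "r \<le> 1"
    using assms by (auto simp: r_def quarter_space_iff)
  have cs0: "0 \<le> c" "0 \<le> s"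
    using assms r by (auto simp: c_def s_def \<sigma>_def \<tau>_def quarter_space_iff)
  have \<phi>: "\<phi>$1 = \<sigma> * (r * c)" "\<phi>$2 = \<tau> * (r * s)"
    using r \<sigma>\<tau> by (simp_all add: c_def s_def mult.assoc[symmetric])
  have r2: "r\<^sup>2 = (\<phi>$1)\<^sup>2 + (\<phi>$2)\<^sup>2" by (simp add: r_def norm_vec2)
  also have "\<dots> = (\<sigma> * \<sigma>) * (r\<^sup>2 * c\<^sup>2) + (\<tau> * \<tau>) * (r\<^sup>2 * s\<^sup>2)"
    unfolding \<phi> by (simp only: power2_eq_square ac_simps)
  also have "\<dots> = r\<^sup>2 * (c\<^sup>2 + s\<^sup>2)"
    by (simp add: \<sigma>\<tau> distrib_left)
  finally have cs: "c\<^sup>2 + s\<^sup>2 = 1" using r by simp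
  have p: "0 \<le> p" "p \<le> 1/2"
    using qk1_kappa_bounds r mult_mono[of \<kappa> "1/2" r 1] by (auto simp: p_def \<kappa>_def)
  have g: "0 \<le> g" "g \<le> 2"
    using qk1_beta_bounds p by (auto simp: g_def \<beta>_def divide_le_eq)
  obtain a b l where nonneg: "0 \<le> a" "0 \<le> b" and ab: "a * s \<le> r * c" "b * c \<le> r * s" "r\<^sup>2 + a\<^sup>2 \<le> 1" "r\<^sup>2 + b\<^sup>2 \<le> 1"
      and prod: "a * b = g * (c * s * r\<^sup>2 * (1 - r\<^sup>2))"
      and l: "0 \<le> l" "l \<le> 1" and la: "l * a = (1 - l) * b"
    using transverse_atoms[OF cs0 cs r g] by blast
  define R where "R = rotated_point i j c s"
  define f where "f k = [R 0 0, R 1 0, R r a, R r (- b)] ! k" for k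
  define w where
    "w k = [u * (p * (1 - r)), u * (p * r), u * ((1 - p) * l), u * ((1 - p) * (1 - l))] ! k" for k
  define I :: "nat set" where "I = {0, 1, 2, 3}"
  have w0: "0 \<le> w k" if "k \<in> I" for k
    using that assms(1) p r l by (auto simp: I_def w_def)
  \<comment> \<open>Each displaced atom moves towards only one edge of the quarter; its other sign
    condition is automatic.\<close>
  have "- (a * c) \<le> r * s" "- (b * s) \<le> r * c"
    by (rule order_trans[of _ 0]; use nonneg cs0 r in simp)+
  then have fQ: "f ` I \<subseteq> quarter_space i j"
    using cs cs0 ab
    by (auto simp: I_def f_def R_def intro!: rotated_point_in_quarter_space)
  define \<psi> where
    "\<psi> = distr (point_measure I (\<lambda>k. ennreal (w k))) (restrict_space borel (quarter_space i j)) f"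
  have fin: "finite I" by (simp add: I_def)
  have integral: "has_bochner_integral \<psi> h (\<Sum>k\<in>I. w k *\<^sub>R h (f k))"
    if "continuous_on UNIV h" for h :: "real^2 \<Rightarrow> 'z :: {banach, second_countable_topology}"
    unfolding \<psi>_def using fin w0 fQ that by (rule has_bochner_integral_point_measure_distr)
  have atoms: "(\<Sum>k\<in>I. w k *\<^sub>R h (f k)) =
      (u * (p * (1 - r))) *\<^sub>R h (R 0 0) + (u * (p * r)) *\<^sub>R h (R 1 0)
      + (u * ((1 - p) * l)) *\<^sub>R h (R r a) + (u * ((1 - p) * (1 - l))) *\<^sub>R h (R r (- b))"
    for h :: "real^2 \<Rightarrow> 'z :: real_vector"
    by (simp add: I_def w_def f_def numeral_2_eq_2 numeral_3_eq_3)
  have mass: "(\<Sum>k\<in>I. w k *\<^sub>R (1::real)) = u"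
    unfolding atoms[of "\<lambda>_. 1"] by (simp add: algebra_simps)
  have mean: "(\<Sum>k\<in>I. w k *\<^sub>R f k) = u *\<^sub>R \<phi>"
  proof -
    have "p * (r * x) + (1 - p) * (l * (r * x + a * y) + (1 - l) * (r * x - b * y)) = r * x"
      for x y using centred_first_moment[OF la, of "r * x" y] by (simp add: algebra_simps)
    \<comment> \<open>\<open>(c, s)\<close> and \<open>(- s, c)\<close> are the reflected axes; one
      instance per coordinate.\<close>
    from this[of c "- s"] this[of s c] show ?thesis
      unfolding atoms[of "\<lambda>v. v"]
      by (simp add: vec_eq_iff forall_2 R_def rotated_point_nth \<phi> \<sigma>_def[symmetric] \<tau>_def[symmetric])
         algebra
  qed
  have \<alpha>\<^sub>1: "qk1_alpha1 \<phi> = (1 - p) * (a * b)"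
  proof -
    have "\<bar>\<sigma>\<bar> = 1" "\<bar>\<tau>\<bar> = 1" unfolding \<sigma>_def \<tau>_def by (cases i; simp) (cases j; simp)
    then have "\<bar>\<phi>$1 * \<phi>$2\<bar> = c * s * r\<^sup>2"
      using r cs0 by (simp add: \<phi> abs_mult power2_eq_square)
    then show ?thesis
      using p by (simp add: qk1_alpha1_def prod g_def \<beta>_def r_def[symmetric])
  qed
  have second: "(\<Sum>k\<in>I. w k *\<^sub>R outer_square (f k)) = u *\<^sub>R qk1_closure \<phi>"
  proof -
    \<comment> \<open>\<open>x * x'\<close> and \<open>y * y'\<close> stand for matching entries of
      the outer squares of the two reflected axes.\<close>
    have moment: "p * r * (x * x') + (1 - p) * (l * ((r * x + a * y) * (r * x' + a * y'))
        + (1 - l) * ((r * x - b * y) * (r * x' - b * y')))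
        = (1 - p) * (a * b) * (y * y') + (1 + \<kappa> * (1 - r)) * (r\<^sup>2 * (x * x'))" for x x' y y'
      unfolding centred_second_moment[OF la] p_def
      by (simp add: power2_eq_square algebra_simps)
    have sc: "s * s = 1 - c * c" using cs by (simp add: power2_eq_square)
    have closure_nth:
      "qk1_closure \<phi> $ k $ m = (1 - p) * (a * b) * ((if k = m then 1 else 0) - \<phi>$k * \<phi>$m / r\<^sup>2)
         + (1 + \<kappa> * (1 - r)) * (\<phi>$k * \<phi>$m)" for k m
      unfolding qk1_closure_decomposition[OF assms(3)] \<alpha>\<^sub>1
      by (simp add: outer_square_nth mat_def r_def \<kappa>_def)
    have \<phi>\<phi>: "\<phi>$1 * \<phi>$1 = r\<^sup>2 * (c * c)" "\<phi>$2 * \<phi>$2 = r\<^sup>2 * (s * s)"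
        "\<phi>$1 * \<phi>$2 = r\<^sup>2 * (\<sigma> * \<tau> * (c * s))" "\<phi>$2 * \<phi>$1 = r\<^sup>2 * (\<sigma> * \<tau> * (c * s))"
      using \<sigma>\<tau> unfolding \<phi> power2_eq_square by algebra+
    have cl: "qk1_closure \<phi> $ 1 $ 1 = (1 - p) * (a * b) * (s * s) + (1 + \<kappa> * (1 - r)) * (r\<^sup>2 * (c * c))"
        "qk1_closure \<phi> $ 2 $ 2 = (1 - p) * (a * b) * (c * c) + (1 + \<kappa> * (1 - r)) * (r\<^sup>2 * (s * s))"
        "qk1_closure \<phi> $ 1 $ 2 = \<sigma> * \<tau> * ((1 - p) * (a * b) * (- s * c) + (1 + \<kappa> * (1 - r)) * (r\<^sup>2 * (c * s)))"
        "qk1_closure \<phi> $ 2 $ 1 = \<sigma> * \<tau> * ((1 - p) * (a * b) * (- s * c) + (1 + \<kappa> * (1 - r)) * (r\<^sup>2 * (c * s)))"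
      unfolding closure_nth \<phi>\<phi> using r by (simp_all add: sc) (simp_all add: algebra_simps)
    show ?thesis
      unfolding atoms vec_eq_iff forall_2
      using moment[of c c "- s" "- s"] moment[of s s c c] moment[of c s "- s" c] \<sigma>\<tau>
      by (simp add: outer_square_nth R_def rotated_point_nth \<sigma>_def[symmetric] \<tau>_def[symmetric] cl)
         (intro conjI; algebra)
  qed
  have "finite_measure \<psi>"
    unfolding \<psi>_def using fin fQ by (rule finite_measure_point_measure_distr)
  moreover have "sets \<psi> = sets (restrict_space borel (quarter_space i j))"
    by (simp add: \<psi>_def)
  moreover have "has_bochner_integral \<psi> (\<lambda>\<Omega>. 1) u"
    using integral[of "\<lambda>_. 1 :: real"] mass by simp
  moreover have "has_bochner_integral \<psi> (\<lambda>\<Omega>. \<Omega>) (u *\<^sub>R \<phi>)"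
    using integral[of "\<lambda>v. v"] mean by simp
  moreover have "has_bochner_integral \<psi> outer_square (u *\<^sub>R qk1_closure \<phi>)"
    using integral[OF continuous_on_outer_square] second by simp
  ultimately show ?thesis by blast
qed

end
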